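(* Let $A$ be a commutative ring with nonzero identity, let $M$ be an $A$-module, $P$ a submodule of $M$ and $I$ an ideal of $A$. Consider the $A\bowtie I$-module $M\bowtie I$. The following statements hold: (i) $(P\bowtie I:_{M\bowtie I}(a,a+i))=(P:_{M}a)\bowtie I$ for every $a\in A$ and $i\in I$. (ii) $(P\bowtie I:_{A\bowtie I}(m,m+m^{\prime}))=(P:_{A}m)\bowtie I$ for every $m\in M$ and $m^{\prime}\in IM$.
   Context: All rings are commutative with nonzero identity; the given module $M$ is nonzero and unital. The amalgamated duplication of $A$ along the ideal $I$ is the subring $A\bowtie I=\{(a,a+i):a\in A,\ i\in I\}$ of $A\times A$ (componentwise operations). The amalgamated duplication of $M$ along $I$ is $M\bowtie I=\{(m,m+m^{\prime}):m\in M,\ m^{\prime}\in IM\}$, an $A\bowtie I$-module with componentwise addition and scalar multiplication $(a,a+i)(m,m+m^{\prime})=(am,(a+i)(m+m^{\prime}))$. For a submodule $N$ of $M$, $N\bowtie I=\{(m,m+m^{\prime}):m\in N,\ m^{\prime}\in IM\}$, an $A\bowtie I$-submodule of $M\bowtie I$; for an ideal $J$ of $A$ (a submodule of the $A$-module $A$), correspondingly $J\bowtie I=\{(a,a+i):a\in J,\ i\in I\}$. For a ring $R$, an $R$-module $X$ and a submodule $Q$ of $X$: $(Q:_{X}r)=\{x\in X: rx\in Q\}$ for $r\in R$ and $(Q:_{R}x)=\{r\in R: rx\in Q\}$ for $x\in X$. *)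

theory Defs
  imports "HOL-Algebra.Module" "HOL-Algebra.Subrings" "HOL-Algebra.Chinese_Remainder"
begin

text \<open>
  The submodule \<open>I M\<close>, i.e. all finite sums of products \<open>i \<odot> m\<close>; this follows
  \<open>ideal_prod\<close> from the library. There is no rule for \<open>\<zero>\<close>, since it is already of the form
  \<open>\<zero> \<odot> \<zero>\<close> when \<open>I\<close> is an ideal.
\<close>
inductive_set ideal_smult :: "('a, 'b, 'm) module_scheme \<Rightarrow> 'a set \<Rightarrow> 'b set"
  for M (structure) and I where
  smult: "\<lbrakk>i \<in> I; m \<in> carrier M\<rbrakk> \<Longrightarrow> i \<odot> m \<in> ideal_smult M I"
| sum: "\<lbrakk>s \<in> ideal_smult M I; t \<in> ideal_smult M I\<rbrakk> \<Longrightarrow> s \<oplus> t \<in> ideal_smult M I"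

definition dup_ideal :: "('a, 'm) ring_scheme \<Rightarrow> 'a set \<Rightarrow> 'a set \<Rightarrow> ('a \<times> 'a) set" where
  "dup_ideal A I J = {(a, a \<oplus>\<^bsub>A\<^esub> i) | a i. a \<in> J \<and> i \<in> I}"

definition dup_ring :: "('a, 'm) ring_scheme \<Rightarrow> 'a set \<Rightarrow> ('a \<times> 'a) ring" where
  "dup_ring A I = (RDirProd A A)\<lparr>carrier := dup_ideal A I (carrier A)\<rparr>"

definition dup_submodule ::
    "('a, 'b, 'm) module_scheme \<Rightarrow> 'a set \<Rightarrow> 'b set \<Rightarrow> ('b \<times> 'b) set" where
  "dup_submodule M I N = {(m, m \<oplus>\<^bsub>M\<^esub> m') | m m'. m \<in> N \<and> m' \<in> ideal_smult M I}"

text \<open>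
  The fields \<open>mult\<close> and \<open>one\<close> are inherited from the ring record and play no role in modules.
\<close>
definition dup_module ::
    "('a, 'b, 'm) module_scheme \<Rightarrow> 'a set \<Rightarrow> ('a \<times> 'a, 'b \<times> 'b) module" where
  "dup_module M I =
    \<lparr>carrier = dup_submodule M I (carrier M),
     mult = undefined,
     one = undefined,
     zero = (\<zero>\<^bsub>M\<^esub>, \<zero>\<^bsub>M\<^esub>),
     add = (\<lambda>(x, y) (x', y'). (x \<oplus>\<^bsub>M\<^esub> x', y \<oplus>\<^bsub>M\<^esub> y')),
     smult = (\<lambda>(r, s) (x, y). (r \<odot>\<^bsub>M\<^esub> x, s \<odot>\<^bsub>M\<^esub> y))\<rparr>"

text \<open>\<open>(Q :\<^sub>X r)\<close> for a scalar \<open>r\<close>, and \<open>(Q :\<^sub>R x)\<close> for a module element \<open>x\<close>.\<close>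

definition colon_scalar :: "('r, 'x, 'm) module_scheme \<Rightarrow> 'x set \<Rightarrow> 'r \<Rightarrow> 'x set" where
  "colon_scalar X Q r = {x \<in> carrier X. r \<odot>\<^bsub>X\<^esub> x \<in> Q}"

definition colon_element ::
    "('r, 'n) ring_scheme \<Rightarrow> ('r, 'x, 'm) module_scheme \<Rightarrow> 'x set \<Rightarrow> 'x \<Rightarrow> 'r set" where
  "colon_element R X Q x = {r \<in> carrier R. r \<odot>\<^bsub>X\<^esub> x \<in> Q}"


text \<open>
  The constructions above are what they should be: \<open>dup_ring\<close> is a subring of the product,
  \<open>dup_module\<close> is a module over it, and \<open>dup_submodule\<close> gives submodules.
\<close>

context module
begin

lemma ideal_smult_closed:
  assumes "ideal I R" "x \<in> ideal_smult M I"
  shows "x \<in> carrier M"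
  using assms(2) by induction (auto intro: ideal.Icarr[OF assms(1)])

lemma ideal_smult_scale:
  assumes I: "ideal I R" and r: "r \<in> carrier R" and x: "x \<in> ideal_smult M I"
  shows "r \<odot>\<^bsub>M\<^esub> x \<in> ideal_smult M I"
  using x
proof induction
  case (smult i m)
  then have "r \<odot>\<^bsub>M\<^esub> (i \<odot>\<^bsub>M\<^esub> m) = (r \<otimes> i) \<odot>\<^bsub>M\<^esub> m"
    using r ideal.Icarr[OF I] by (simp add: smult_assoc1)
  then show ?case
    using smult r ideal.I_l_closed[OF I] by (auto intro: ideal_smult.smult)
next
  case (sum s t)
  then show ?case
    using r ideal_smult_closed[OF I] by (auto simp: smult_r_distr intro: ideal_smult.sum)
qed

lemma ideal_smult_submodule:
  assumes I: "ideal I R"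
  shows "submodule (ideal_smult M I) R M"
proof (rule submoduleI)
  show "ideal_smult M I \<subseteq> carrier M"
    using ideal_smult_closed[OF I] by blast
  have "\<zero> \<odot>\<^bsub>M\<^esub> \<zero>\<^bsub>M\<^esub> \<in> ideal_smult M I"
    using I by (intro ideal_smult.smult) (auto simp: ideal_def additive_subgroup.zero_closed)
  then show "\<zero>\<^bsub>M\<^esub> \<in> ideal_smult M I"
    by simp
  show "\<ominus>\<^bsub>M\<^esub> x \<in> ideal_smult M I" if "x \<in> ideal_smult M I" for x
  proof -
    have "(\<ominus> \<one>) \<odot>\<^bsub>M\<^esub> x = \<ominus>\<^bsub>M\<^esub> x"
      using ideal_smult_closed[OF I that] by (simp add: smult_l_minus)
    then show ?thesis
      using ideal_smult_scale[OF I _ that, of "\<ominus> \<one>"] by simp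
  qed
qed (auto intro: ideal_smult.sum ideal_smult_scale[OF I])

lemma mem_dup_ideal:
  assumes I: "ideal I R" and J: "J \<subseteq> carrier R"
  shows "p \<in> dup_ideal R I J \<longleftrightarrow>
    fst p \<in> J \<and> snd p \<in> carrier R \<and> snd p \<ominus> fst p \<in> I"
proof
  interpret I: ideal I R by fact
  show "fst p \<in> J \<and> snd p \<in> carrier R \<and> snd p \<ominus> fst p \<in> I" if p: "p \<in> dup_ideal R I J"
  proof -
    obtain a i where *: "p = (a, a \<oplus> i)" "a \<in> J" "i \<in> I"
      using p by (auto simp: dup_ideal_def)
    then have "a \<in> carrier R" "i \<in> carrier R"
      using J I.Icarr by auto
    moreover from this have "(a \<oplus> i) \<ominus> a = i"
      by algebra
    ultimately show ?thesis
      using * by simp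
  qed
  show "p \<in> dup_ideal R I J" if p: "fst p \<in> J \<and> snd p \<in> carrier R \<and> snd p \<ominus> fst p \<in> I"
  proof -
    have "fst p \<in> carrier R" "snd p \<in> carrier R"
      using p J by auto
    then have "snd p = fst p \<oplus> (snd p \<ominus> fst p)"
      by algebra
    then have "p = (fst p, fst p \<oplus> (snd p \<ominus> fst p))"
      by (metis prod.collapse)
    then show ?thesis
      using p unfolding dup_ideal_def by blast
  qed
qed

lemma mem_dup_submodule:
  assumes I: "ideal I R" and N: "N \<subseteq> carrier M"
  shows "p \<in> dup_submodule M I N \<longleftrightarrow>
    fst p \<in> N \<and> snd p \<in> carrier M \<and> snd p \<ominus>\<^bsub>M\<^esub> fst p \<in> ideal_smult M I"
proof
  show "fst p \<in> N \<and> snd p \<in> carrier M \<and> snd p \<ominus>\<^bsub>M\<^esub> fst p \<in> ideal_smult M I"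
    if p: "p \<in> dup_submodule M I N"
  proof -
    obtain a i where *: "p = (a, a \<oplus>\<^bsub>M\<^esub> i)" "a \<in> N" "i \<in> ideal_smult M I"
      using p by (auto simp: dup_submodule_def)
    then have c: "a \<in> carrier M" "i \<in> carrier M"
      using N ideal_smult_closed[OF I] by auto
    then have "(a \<oplus>\<^bsub>M\<^esub> i) \<ominus>\<^bsub>M\<^esub> a = i"
      by (metis M.a_comm M.add.inv_solve_right' M.add.m_closed M.minus_eq)
    then show ?thesis
      using * c by simp
  qed
  show "p \<in> dup_submodule M I N"
    if p: "fst p \<in> N \<and> snd p \<in> carrier M \<and> snd p \<ominus>\<^bsub>M\<^esub> fst p \<in> ideal_smult M I"
  proof -
    have "fst p \<in> carrier M" "snd p \<in> carrier M"
      using p N by auto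
    then have "snd p = fst p \<oplus>\<^bsub>M\<^esub> (snd p \<ominus>\<^bsub>M\<^esub> fst p)"
      by (metis M.a_assoc M.a_comm M.a_inv_closed M.l_neg M.r_zero M.minus_eq)
    then have "p = (fst p, fst p \<oplus>\<^bsub>M\<^esub> (snd p \<ominus>\<^bsub>M\<^esub> fst p))"
      by (metis prod.collapse)
    then show ?thesis
      using p unfolding dup_submodule_def by blast
  qed
qed

lemma dup_ring_subring:
  assumes I: "ideal I R"
  shows "subring (carrier (dup_ring R I)) (RDirProd R R)"
    and "cring (dup_ring R I)"
proof -
  interpret I: ideal I R by fact
  interpret P: ring "RDirProd R R"
    by (intro RDirProd_ring R.ring_axioms)
  have inv: "\<ominus>\<^bsub>RDirProd R R\<^esub> p = (\<ominus> fst p, \<ominus> snd p)" if "p \<in> carrier R \<times> carrier R" for p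
    using that
    by (intro P.minus_equality)
       (auto simp: RDirProd_def DirProd_def monoid.defs R.l_neg)
  have sub: "subring (dup_ideal R I (carrier R)) (RDirProd R R)"
  proof (rule P.subringI)
    show "dup_ideal R I (carrier R) \<subseteq> carrier (RDirProd R R)"
      by (auto simp: mem_dup_ideal[OF I] RDirProd_carrier)
    show "\<one>\<^bsub>RDirProd R R\<^esub> \<in> dup_ideal R I (carrier R)"
      by (auto simp: mem_dup_ideal[OF I] RDirProd_def DirProd_def monoid.defs
          a_minus_def R.r_neg I.zero_closed)
  next
    fix p assume "p \<in> dup_ideal R I (carrier R)"
    then have p: "fst p \<in> carrier R" "snd p \<in> carrier R" "snd p \<ominus> fst p \<in> I"
      by (auto simp: mem_dup_ideal[OF I])
    have "\<ominus> snd p \<ominus> (\<ominus> fst p) = \<ominus> (snd p \<ominus> fst p)"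
      using p by algebra
    then show "\<ominus>\<^bsub>RDirProd R R\<^esub> p \<in> dup_ideal R I (carrier R)"
      using p by (auto simp: mem_dup_ideal[OF I] inv mem_Times_iff I.a_inv_closed)
  next
    fix p q assume "p \<in> dup_ideal R I (carrier R)" "q \<in> dup_ideal R I (carrier R)"
    then have p: "fst p \<in> carrier R" "snd p \<in> carrier R" "snd p \<ominus> fst p \<in> I"
      and q: "fst q \<in> carrier R" "snd q \<in> carrier R" "snd q \<ominus> fst q \<in> I"
      by (auto simp: mem_dup_ideal[OF I])
    have "snd p \<otimes> snd q \<ominus> fst p \<otimes> fst q =
        (snd p \<ominus> fst p) \<otimes> snd q \<oplus> fst p \<otimes> (snd q \<ominus> fst q)"
      using p q by algebra
    also have "\<dots> \<in> I"
      using p q by (intro I.a_closed I.I_l_closed I.I_r_closed)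
    finally show "p \<otimes>\<^bsub>RDirProd R R\<^esub> q \<in> dup_ideal R I (carrier R)"
      using p q
      by (auto simp: mem_dup_ideal[OF I] RDirProd_def DirProd_def monoid.defs split: prod.splits)
    have "(snd p \<oplus> snd q) \<ominus> (fst p \<oplus> fst q) = (snd p \<ominus> fst p) \<oplus> (snd q \<ominus> fst q)"
      using p q by algebra
    also have "\<dots> \<in> I"
      using p q by (intro I.a_closed)
    finally show "p \<oplus>\<^bsub>RDirProd R R\<^esub> q \<in> dup_ideal R I (carrier R)"
      using p q
      by (auto simp: mem_dup_ideal[OF I] RDirProd_def DirProd_def monoid.defs split: prod.splits)
  qed
  then show "subring (carrier (dup_ring R I)) (RDirProd R R)"
    by (simp add: dup_ring_def)
  have "ring (dup_ring R I)"
    using P.subring_is_ring[OF sub] by (simp add: dup_ring_def)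
  then show "cring (dup_ring R I)"
  proof (intro cring.intro)
    interpret D: ring "dup_ring R I" by fact
    show "comm_monoid (dup_ring R I)"
      by (rule D.monoid_comm_monoidI)
         (auto simp: dup_ring_def mem_dup_ideal[OF I] RDirProd_def DirProd_def monoid.defs R.m_comm)
  qed
qed

lemma dup_submodule_closed:
  assumes I: "ideal I R" and N: "submodule N R M"
  shows "(\<zero>\<^bsub>M\<^esub>, \<zero>\<^bsub>M\<^esub>) \<in> dup_submodule M I N"
    and "\<lbrakk>(x, y) \<in> dup_submodule M I N; (x', y') \<in> dup_submodule M I N\<rbrakk>
      \<Longrightarrow> (x \<oplus>\<^bsub>M\<^esub> x', y \<oplus>\<^bsub>M\<^esub> y') \<in> dup_submodule M I N"
    and "(x, y) \<in> dup_submodule M I N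
      \<Longrightarrow> (\<ominus>\<^bsub>M\<^esub> x, \<ominus>\<^bsub>M\<^esub> y) \<in> dup_submodule M I N"
    and "\<lbrakk>(r, s) \<in> dup_ideal R I (carrier R); (x, y) \<in> dup_submodule M I N\<rbrakk>
      \<Longrightarrow> (r \<odot>\<^bsub>M\<^esub> x, s \<odot>\<^bsub>M\<^esub> y) \<in> dup_submodule M I N"
proof -
  note Nsub = submoduleE[OF N]
  note IM = submoduleE[OF ideal_smult_submodule[OF I]]
  have zero: "\<zero>\<^bsub>M\<^esub> \<in> H" if "submodule H R M" for H
    using subgroup.one_closed[OF submodule.axioms(1)[OF that]] by simp
  note mem = mem_dup_submodule[OF I Nsub(1)]
  show "(\<zero>\<^bsub>M\<^esub>, \<zero>\<^bsub>M\<^esub>) \<in> dup_submodule M I N"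
    using zero[OF N] zero[OF ideal_smult_submodule[OF I]] by (simp add: mem a_minus_def M.r_neg)
  show "(x \<oplus>\<^bsub>M\<^esub> x', y \<oplus>\<^bsub>M\<^esub> y') \<in> dup_submodule M I N"
    if "(x, y) \<in> dup_submodule M I N" "(x', y') \<in> dup_submodule M I N"
  proof -
    have *: "x \<in> N" "y \<in> carrier M" "y \<ominus>\<^bsub>M\<^esub> x \<in> ideal_smult M I"
      "x' \<in> N" "y' \<in> carrier M" "y' \<ominus>\<^bsub>M\<^esub> x' \<in> ideal_smult M I"
      using that by (auto simp: mem)
    then have c: "x \<in> carrier M" "x' \<in> carrier M"
      using Nsub(1) by auto
    have "(y \<oplus>\<^bsub>M\<^esub> y') \<ominus>\<^bsub>M\<^esub> (x \<oplus>\<^bsub>M\<^esub> x') = (y \<ominus>\<^bsub>M\<^esub> x) \<oplus>\<^bsub>M\<^esub> (y' \<ominus>\<^bsub>M\<^esub> x')"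
      using * c by (simp add: a_minus_def M.minus_add M.a_ac)
    then show ?thesis
      using * Nsub(5) IM(5) by (simp add: mem)
  qed
  show "(\<ominus>\<^bsub>M\<^esub> x, \<ominus>\<^bsub>M\<^esub> y) \<in> dup_submodule M I N" if "(x, y) \<in> dup_submodule M I N"
  proof -
    have *: "x \<in> N" "y \<in> carrier M" "y \<ominus>\<^bsub>M\<^esub> x \<in> ideal_smult M I"
      using that by (auto simp: mem)
    then have c: "x \<in> carrier M"
      using Nsub(1) by auto
    have "\<ominus>\<^bsub>M\<^esub> y \<ominus>\<^bsub>M\<^esub> (\<ominus>\<^bsub>M\<^esub> x) = \<ominus>\<^bsub>M\<^esub> (y \<ominus>\<^bsub>M\<^esub> x)"
      using * c by (simp add: a_minus_def M.minus_add M.a_ac)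
    then show ?thesis
      using * Nsub(3) IM(3) by (simp add: mem)
  qed
  show "(r \<odot>\<^bsub>M\<^esub> x, s \<odot>\<^bsub>M\<^esub> y) \<in> dup_submodule M I N"
    if "(r, s) \<in> dup_ideal R I (carrier R)" "(x, y) \<in> dup_submodule M I N"
  proof -
    have *: "x \<in> N" "y \<in> carrier M" "y \<ominus>\<^bsub>M\<^esub> x \<in> ideal_smult M I"
      using that by (auto simp: mem)
    have **: "r \<in> carrier R" "s \<in> carrier R" "s \<ominus> r \<in> I"
      using that by (auto simp: mem_dup_ideal[OF I])
    have c: "x \<in> carrier M"
      using * Nsub(1) by auto
    have "s \<odot>\<^bsub>M\<^esub> y \<ominus>\<^bsub>M\<^esub> r \<odot>\<^bsub>M\<^esub> x = s \<odot>\<^bsub>M\<^esub> (y \<ominus>\<^bsub>M\<^esub> x) \<oplus>\<^bsub>M\<^esub> (s \<ominus> r) \<odot>\<^bsub>M\<^esub> x"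
    proof -
      have "s \<odot>\<^bsub>M\<^esub> (y \<ominus>\<^bsub>M\<^esub> x) \<oplus>\<^bsub>M\<^esub> (s \<ominus> r) \<odot>\<^bsub>M\<^esub> x
        = (s \<odot>\<^bsub>M\<^esub> y \<oplus>\<^bsub>M\<^esub> \<ominus>\<^bsub>M\<^esub> (s \<odot>\<^bsub>M\<^esub> x)) \<oplus>\<^bsub>M\<^esub> (s \<odot>\<^bsub>M\<^esub> x \<oplus>\<^bsub>M\<^esub> \<ominus>\<^bsub>M\<^esub> (r \<odot>\<^bsub>M\<^esub> x))"
        using * ** c
        by (simp add: a_minus_def smult_r_distr smult_l_distr smult_l_minus smult_r_minus)
      also have "\<dots> = s \<odot>\<^bsub>M\<^esub> y \<ominus>\<^bsub>M\<^esub> r \<odot>\<^bsub>M\<^esub> x"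
        using * ** c by (simp add: a_minus_def M.a_assoc M.r_neg1)
      finally show ?thesis
        by simp
    qed
    also have "\<dots> \<in> ideal_smult M I"
      using * ** c ideal_smult_scale[OF I] by (intro IM(5)) (auto intro: ideal_smult.smult)
    finally show ?thesis
      using * ** Nsub(4) by (simp add: mem)
  qed
qed

lemma dup_module_module:
  assumes I: "ideal I R"
  shows "module (dup_ring R I) (dup_module M I)"
proof (rule moduleI)
  note closed = dup_submodule_closed[OF I carrier_is_submodule]
  note mem = mem_dup_submodule[OF I order.refl]
  note mem' = mem_dup_ideal[OF I order.refl]
  show "cring (dup_ring R I)"
    by (rule dup_ring_subring[OF I])
  show "abelian_group (dup_module M I)"
  proof (rule abelian_groupI)
    fix p assume p: "p \<in> carrier (dup_module M I)"
    have "(\<ominus>\<^bsub>M\<^esub> fst p, \<ominus>\<^bsub>M\<^esub> snd p) \<in> carrier (dup_module M I)"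
      using p closed(3)[of "fst p" "snd p"] by (simp add: dup_module_def)
    moreover have "(\<ominus>\<^bsub>M\<^esub> fst p, \<ominus>\<^bsub>M\<^esub> snd p) \<oplus>\<^bsub>dup_module M I\<^esub> p = \<zero>\<^bsub>dup_module M I\<^esub>"
      using p by (auto simp: dup_module_def mem M.l_neg split: prod.splits)
    ultimately show
      "\<exists>q\<in>carrier (dup_module M I). q \<oplus>\<^bsub>dup_module M I\<^esub> p = \<zero>\<^bsub>dup_module M I\<^esub>"
      by blast
  qed (auto simp: dup_module_def intro: closed, auto simp: mem M.a_ac)
qed (auto simp: dup_module_def dup_ring_def RDirProd_def DirProd_def monoid.defs
       intro: dup_submodule_closed[OF I carrier_is_submodule],
     auto simp: mem_dup_submodule[OF I order.refl] mem_dup_ideal[OF I order.refl]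
       smult_l_distr smult_r_distr smult_assoc1)

lemma dup_submodule_submodule:
  assumes I: "ideal I R" and N: "submodule N R M"
  shows "submodule (dup_submodule M I N) (dup_ring R I) (dup_module M I)"
proof -
  interpret D: module "dup_ring R I" "dup_module M I"
    by (rule dup_module_module[OF I])
  note closed = dup_submodule_closed[OF I N]
  have sub: "dup_submodule M I N \<subseteq> dup_submodule M I (carrier M)"
    using submoduleE(1)[OF N] by (auto simp: dup_submodule_def)
  show ?thesis
  proof (rule D.submoduleI)
    fix p assume p: "p \<in> dup_submodule M I N"
    have c: "(\<ominus>\<^bsub>M\<^esub> fst p, \<ominus>\<^bsub>M\<^esub> snd p) \<in> dup_submodule M I N"
      using p closed(3)[of "fst p" "snd p"] by simp
    have "p \<in> dup_submodule M I (carrier M)"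
      using p sub by blast
    then have "(\<ominus>\<^bsub>M\<^esub> fst p, \<ominus>\<^bsub>M\<^esub> snd p) \<oplus>\<^bsub>dup_module M I\<^esub> p = \<zero>\<^bsub>dup_module M I\<^esub>"
      by (auto simp: dup_module_def mem_dup_submodule[OF I order.refl] M.l_neg split: prod.splits)
    then have "\<ominus>\<^bsub>dup_module M I\<^esub> p = (\<ominus>\<^bsub>M\<^esub> fst p, \<ominus>\<^bsub>M\<^esub> snd p)"
      using p c sub by (intro D.minus_equality) (auto simp: dup_module_def)
    then show "\<ominus>\<^bsub>dup_module M I\<^esub> p \<in> dup_submodule M I N"
      using c by simp
  qed (use sub in \<open>auto simp: dup_module_def dup_ring_def intro: closed\<close>)
qed

end

end

theory Submission
  imports Defs
begin

text \<open>
  A pair of \<open>M \<bowtie> I\<close> belongs to \<open>N \<bowtie> I\<close> exactly when its first coordinate belongs to \<open>N\<close>: the second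
  coordinate is constrained only modulo \<open>I M\<close>, and that constraint is already part of lying in
  \<open>M \<bowtie> I\<close>. The same holds for ideals inside \<open>A \<bowtie> I\<close>. Both colon sets of the theorem ask whether a
  product \<open>(r, s) \<cdot> (x, y)\<close> lies in \<open>P \<bowtie> I\<close>. The product lies in \<open>M \<bowtie> I\<close> because \<open>M \<bowtie> I\<close> is
  a module over \<open>A \<bowtie> I\<close>, so the question is only whether \<open>r x\<close> lies in \<open>P\<close>. Fixing the scalar gives a
  condition on \<open>x\<close> and yields (i); fixing the module element gives a condition on \<open>r\<close> and yields (ii).
\<close>

lemma dup_submodule_eq_fst:
  assumes "N \<subseteq> carrier M"
  shows "dup_submodule M I N = {p \<in> carrier (dup_module M I). fst p \<in> N}"
  using assms by (auto simp: dup_submodule_def dup_module_def)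

lemma dup_ideal_eq_fst:
  assumes "J \<subseteq> carrier A"
  shows "dup_ideal A I J = {p \<in> carrier (dup_ring A I). fst p \<in> J}"
  using assms by (auto simp: dup_ideal_def dup_ring_def)

lemma fst_dup_smult: "fst (r \<odot>\<^bsub>dup_module M I\<^esub> p) = fst r \<odot>\<^bsub>M\<^esub> fst p"
  by (simp add: dup_module_def split: prod.splits)

context module
begin

text \<open>
  The common core of both colon formulas: over \<open>A \<bowtie> I\<close>, membership of a product in \<open>N \<bowtie> I\<close> does not
  depend on the second coordinates.
\<close>

lemma dup_smult_mem_iff:
  assumes I: "ideal I R" and N: "N \<subseteq> carrier M"
    and r: "r \<in> carrier (dup_ring R I)" and p: "p \<in> carrier (dup_module M I)"
  shows "r \<odot>\<^bsub>dup_module M I\<^esub> p \<in> dup_submodule M I N \<longleftrightarrow> fst r \<odot>\<^bsub>M\<^esub> fst p \<in> N"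
proof -
  have "r \<odot>\<^bsub>dup_module M I\<^esub> p \<in> carrier (dup_module M I)"
    by (rule module.smult_closed[OF dup_module_module[OF I] r p])
  then show ?thesis
    by (simp add: dup_submodule_eq_fst[OF N] fst_dup_smult)
qed

lemma colon_scalar_dup:
  assumes I: "ideal I R" and N: "N \<subseteq> carrier M" and r: "r \<in> carrier (dup_ring R I)"
  shows "colon_scalar (dup_module M I) (dup_submodule M I N) r
    = dup_submodule M I (colon_scalar M N (fst r))"
proof -
  have sub: "colon_scalar M N (fst r) \<subseteq> carrier M"
    by (auto simp: colon_scalar_def)
  have "fst p \<in> carrier M" if "p \<in> carrier (dup_module M I)" for p
    using that by (auto simp: dup_module_def dup_submodule_def)
  then show ?thesis
    unfolding dup_submodule_eq_fst[OF sub]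
    by (auto simp: colon_scalar_def dup_smult_mem_iff[OF I N r])
qed

lemma colon_element_dup:
  assumes I: "ideal I R" and N: "N \<subseteq> carrier M" and p: "p \<in> carrier (dup_module M I)"
  shows "colon_element (dup_ring R I) (dup_module M I) (dup_submodule M I N) p
    = dup_ideal R I (colon_element R M N (fst p))"
proof -
  have sub: "colon_element R M N (fst p) \<subseteq> carrier R"
    by (auto simp: colon_element_def)
  have "fst r \<in> carrier R" if "r \<in> carrier (dup_ring R I)" for r
    using that by (auto simp: dup_ring_def dup_ideal_def)
  then show ?thesis
    unfolding dup_ideal_eq_fst[OF sub]
    by (auto simp: colon_element_def dup_smult_mem_iff[OF I N _ p])
qed

end

theorem lemma2:
  fixes A :: "('a, 'm) ring_scheme"
    and M :: "('a, 'b, 'n) module_scheme"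
    and P :: "'b set"
    and I :: "'a set"
  assumes "module A M"
    and "\<one>\<^bsub>A\<^esub> \<noteq> \<zero>\<^bsub>A\<^esub>"
    and "carrier M \<noteq> {\<zero>\<^bsub>M\<^esub>}"
    and "submodule P A M"
    and "ideal I A"
  shows "(\<forall>a \<in> carrier A. \<forall>i \<in> I.
            colon_scalar (dup_module M I) (dup_submodule M I P) (a, a \<oplus>\<^bsub>A\<^esub> i)
              = dup_submodule M I (colon_scalar M P a)) \<and>
         (\<forall>m \<in> carrier M. \<forall>m' \<in> ideal_smult M I.
            colon_element (dup_ring A I) (dup_module M I) (dup_submodule M I P) (m, m \<oplus>\<^bsub>M\<^esub> m')
              = dup_ideal A I (colon_element A M P m))"
proof -
  interpret module A M by fact
  have P: "P \<subseteq> carrier M"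
    by (rule submoduleE(1)[OF assms(4)])
  have "(a, a \<oplus>\<^bsub>A\<^esub> i) \<in> carrier (dup_ring A I)" if "a \<in> carrier A" "i \<in> I" for a i
    using that by (auto simp: dup_ring_def dup_ideal_def)
  moreover have "(m, m \<oplus>\<^bsub>M\<^esub> m') \<in> carrier (dup_module M I)"
    if "m \<in> carrier M" "m' \<in> ideal_smult M I" for m m'
    using that by (auto simp: dup_module_def dup_submodule_def)
  ultimately show ?thesis
    by (simp add: colon_scalar_dup[OF assms(5) P] colon_element_dup[OF assms(5) P])
qed

end
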